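(* Assume the Hadamard conjecture, i.e. that a Hadamard matrix of order $4k$ exists for every positive integer $k$. Let $H$ be a Hadamard matrix of order $n$, and suppose $H$ has a submatrix $M$ of order $m<n$ which is a maximal determinant matrix, i.e. $|\det(M)| = D(m)$. Then $m < n/2 + 5\ln n$ or $m \ge n-2$.
   Context: A Hadamard matrix of order $n$ is an $n\times n$ matrix $H$ with entries in $\{+1,-1\}$ satisfying $HH^T = nI$. A submatrix of order $m$ is obtained by selecting any $m$ rows and any $m$ columns. For a positive integer $m$, $D(m)$ denotes the maximum of $|\det(A)|$ over all $m\times m$ matrices $A$ with entries in $\{+1,-1\}$. $\ln$ denotes the natural logarithm. *)

theory Defs
  imports Complex_Main "Jordan_Normal_Form.Determinant" "Jordan_Normal_Form.DL_Submatrix"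
begin

definition pm1_mats :: "nat \<Rightarrow> real mat set" where
  "pm1_mats n = {A \<in> carrier_mat n n. elements_mat A \<subseteq> {1, -1}}"

definition hadamard :: "nat \<Rightarrow> real mat \<Rightarrow> bool" where
  "hadamard n H \<longleftrightarrow> H \<in> pm1_mats n \<and> H * transpose_mat H = real n \<cdot>\<^sub>m 1\<^sub>m n"

definition hadamard_conjecture :: bool where
  "hadamard_conjecture \<longleftrightarrow> (\<forall>k\<ge>1. \<exists>H. hadamard (4 * k) H)"

definition maxdet :: "nat \<Rightarrow> real" where
  "maxdet m = Max ((\<lambda>A. \<bar>det A\<bar>) ` pm1_mats m)"

(* Max is only specified on finite nonempty sets; the next two facts show that it is a
   genuine maximum in maxdet. *)

lemma finite_pm1_mats: "finite (pm1_mats n)"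
proof -
  let ?F = "{f. \<forall>x. (x \<in> {..<n} \<times> {..<n} \<longrightarrow> f x \<in> {1, -1 :: real}) \<and>
                  (x \<notin> {..<n} \<times> {..<n} \<longrightarrow> f x = 0)}"
  have "finite ?F"
    by (rule finite_set_of_finite_funs) auto
  moreover have "pm1_mats n \<subseteq> mat n n ` ?F"
  proof
    fix A assume A: "A \<in> pm1_mats n"
    let ?f = "\<lambda>x. if x \<in> {..<n} \<times> {..<n} then A $$ x else 0"
    have "A = mat n n ?f"
      using A by (intro eq_matI) (auto simp: pm1_mats_def)
    moreover have "A $$ (i, j) \<in> {1, -1}" if "i < n" "j < n" for i j
      using A that elements_matI[of A n n i j] unfolding pm1_mats_def by blast
    then have "?f \<in> ?F" by auto
    ultimately show "A \<in> mat n n ` ?F" by blast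
  qed
  ultimately show ?thesis by (rule finite_surj)
qed

lemma pm1_mats_nonempty: "pm1_mats n \<noteq> {}"
proof -
  have "mat n n (\<lambda>_. 1) \<in> pm1_mats n"
    by (auto simp: pm1_mats_def dest!: elements_matD)
  then show ?thesis by blast
qed

end

theory Submission
  imports Defs "HOL-Analysis.Convex"
begin

text \<open>Put \<open>d = n - m\<close>. The minor \<open>det M\<close> of \<open>H\<close> and the complementary minor of order \<open>d\<close>
  differ in modulus by the factor \<open>n\<^bsup>n/2 - d\<^esup>\<close>. Hadamard's inequality for the complementary minor
  therefore gives \<open>D(m)\<^sup>2 \<le> n\<^bsup>n - 2d\<^esup> d\<^sup>d\<close>. In the other direction, the Hadamard conjecture supplies
  matrices of order \<open>m\<close>, \<open>m + 1\<close>, \<open>m + 2\<close> or \<open>m - 1\<close>, according to \<open>m\<close> modulo 4, and passing to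
  minors or bordering shows that \<open>D(m)\<^sup>2\<close> is at least \<open>m\<^sup>m\<close>, \<open>m\<^bsup>m-1\<^esup>\<close> or \<open>4 m\<^bsup>m-2\<^esup>\<close>.
  The logarithm of \<open>m\<^sup>m / (n\<^bsup>n - 2d\<^esup> d\<^sup>d)\<close> is concave in \<open>d \<le> n/2\<close> and vanishes at
  \<open>d = n/2\<close>, so evaluating it at \<open>d = 6\<close> and \<open>d = n/7\<close> settles \<open>6 \<le> d \<le> n/2 - 5 ln n\<close>.
  For \<open>d \<le> 5\<close> the sharper lower bounds are needed; they apply because \<open>4\<close> divides \<open>n\<close>, so that
  \<open>d\<close> determines \<open>m\<close> modulo 4.\<close>

section \<open>Hadamard matrices and their complementary minors\<close>

lemma pm1_mats_iff:
  "A \<in> pm1_mats n \<longleftrightarrow> A \<in> carrier_mat n n \<and> (\<forall>i<n. \<forall>j<n. A $$ (i, j) \<in> {1, -1})"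
proof -
  have "elements_mat A \<subseteq> {1, -1} \<longleftrightarrow> (\<forall>i<n. \<forall>j<n. A $$ (i, j) \<in> {1, -1})"
    if A: "A \<in> carrier_mat n n"
  proof
    assume *: "elements_mat A \<subseteq> {1, -1}"
    show "\<forall>i<n. \<forall>j<n. A $$ (i, j) \<in> {1, -1}"
      using * A by (meson elements_matI subsetD)
  next
    assume *: "\<forall>i<n. \<forall>j<n. A $$ (i, j) \<in> {1, -1}"
    show "elements_mat A \<subseteq> {1, -1}"
    proof
      fix a assume "a \<in> elements_mat A"
      then obtain i j where "i < n" "j < n" "a = A $$ (i, j)"
        using A by (auto dest!: elements_matD)
      then show "a \<in> {1, -1}" using * by simp
    qed
  qed
  then show ?thesis by (auto simp: pm1_mats_def)
qed

lemma hadamard_row_sum: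
  assumes "hadamard n H" "i < n" "k < n"
  shows "(\<Sum>j<n. H $$ (i, j) * H $$ (k, j)) = (if i = k then real n else 0)"
proof -
  have H: "H \<in> carrier_mat n n" and eq: "H * transpose_mat H = real n \<cdot>\<^sub>m 1\<^sub>m n"
    using assms by (auto simp: hadamard_def pm1_mats_iff)
  have "(H * transpose_mat H) $$ (i, k) = (\<Sum>j<n. H $$ (i, j) * H $$ (k, j))"
    using H assms(2,3) by (simp add: scalar_prod_def lessThan_atLeast0)
  moreover have "(real n \<cdot>\<^sub>m 1\<^sub>m n :: real mat) $$ (i, k) = (if i = k then real n else 0)"
    using assms(2,3) by simp
  ultimately show ?thesis by (simp add: eq)
qed

lemma hadamardI:
  assumes "H \<in> pm1_mats n"
    and "\<And>i k. i < n \<Longrightarrow> k < n \<Longrightarrow>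
      (\<Sum>j<n. H $$ (i, j) * H $$ (k, j)) = (if i = k then real n else 0)"
  shows "hadamard n H"
  unfolding hadamard_def
proof (intro conjI assms(1) eq_matI)
  fix i k assume "i < dim_row (real n \<cdot>\<^sub>m 1\<^sub>m n :: real mat)" "k < dim_col (real n \<cdot>\<^sub>m 1\<^sub>m n :: real mat)"
  then have ik: "i < n" "k < n" by auto
  then show "(H * transpose_mat H) $$ (i, k) = (real n \<cdot>\<^sub>m 1\<^sub>m n) $$ (i, k)"
    using assms(1) assms(2)[OF ik] by (auto simp: pm1_mats_iff scalar_prod_def lessThan_atLeast0)
qed (use assms(1) in \<open>auto simp: pm1_mats_iff\<close>)

lemma hadamard_permute:
  assumes H: "hadamard n H" and f: "bij_betw f {..<n} {..<n}" and g: "bij_betw g {..<n} {..<n}"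
  shows "hadamard n (mat n n (\<lambda>(i, j). H $$ (f i, g j)))"
proof (rule hadamardI)
  have fg: "f i < n" "g i < n" if "i < n" for i
    using that f g by (auto simp: bij_betw_def)
  show "mat n n (\<lambda>(i, j). H $$ (f i, g j)) \<in> pm1_mats n"
    using H fg by (auto simp: hadamard_def pm1_mats_iff)
  fix i k assume ik: "i < n" "k < n"
  have "(\<Sum>j<n. H $$ (f i, g j) * H $$ (f k, g j)) = (\<Sum>j<n. H $$ (f i, j) * H $$ (f k, j))"
    by (rule sum.reindex_bij_betw[OF g])
  also have "\<dots> = (if f i = f k then real n else 0)"
    using H fg ik by (simp add: hadamard_row_sum)
  also have "f i = f k \<longleftrightarrow> i = k"
    using f ik by (auto simp: bij_betw_def inj_on_def)
  finally show "(\<Sum>j<n. mat n n (\<lambda>(i, j). H $$ (f i, g j)) $$ (i, j) *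
      mat n n (\<lambda>(i, j). H $$ (f i, g j)) $$ (k, j)) = (if i = k then real n else 0)"
    using ik by simp
qed

lemma hadamard_det_square:
  assumes "hadamard n H"
  shows "(det H)\<^sup>2 = real n ^ n"
proof -
  have H: "H \<in> carrier_mat n n" and eq: "H * transpose_mat H = real n \<cdot>\<^sub>m 1\<^sub>m n"
    using assms by (auto simp: hadamard_def pm1_mats_iff)
  have "(det H)\<^sup>2 = det (H * transpose_mat H)"
    using H by (simp add: det_mult[of _ n] det_transpose[of _ n] power2_eq_square)
  then show ?thesis by (simp add: eq)
qed

text \<open>The first \<open>a\<close> columns of \<open>X\<close> are unit vectors, its last
  \<open>d\<close> columns are the last \<open>d\<close> rows of \<open>H\<close>. Row orthogonality
  makes \<open>H * X\<close> block lower triangular, so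
  \<open>det H * det D = det A * n^d\<close>.\<close>

lemma hadamard_complementary_minor:
  assumes H: "hadamard n H" and n: "n = a + d"
  shows "(det (mat a a (\<lambda>(i, j). H $$ (i, j))))\<^sup>2 * real n ^ (2 * d) =
    real n ^ n * (det (mat d d (\<lambda>(i, j). H $$ (a + i, a + j))))\<^sup>2"
proof -
  define A where "A = mat a a (\<lambda>(i, j). H $$ (i, j))"
  define C where "C = mat d a (\<lambda>(i, j). H $$ (a + i, j))"
  define D where "D = mat d d (\<lambda>(i, j). H $$ (a + i, a + j))"
  define X where "X = four_block_mat (1\<^sub>m a) (transpose_mat C) (0\<^sub>m d a) (transpose_mat D)"
  define Y where "Y = four_block_mat A (0\<^sub>m a d) C (real n \<cdot>\<^sub>m 1\<^sub>m d)"
  have cH: "H \<in> carrier_mat n n"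
    using H by (auto simp: hadamard_def pm1_mats_iff)
  have carr: "A \<in> carrier_mat a a" "C \<in> carrier_mat d a" "D \<in> carrier_mat d d"
    by (auto simp: A_def C_def D_def)
  have X: "X \<in> carrier_mat n n"
    using carr by (auto simp: X_def n)
  have detX: "det X = det D"
    unfolding X_def using carr
    by (subst det_four_block_mat_lower_left_zero) (auto simp: det_transpose)
  have detY: "det Y = det A * real n ^ d"
    unfolding Y_def using carr by (subst det_four_block_mat_upper_right_zero) auto
  have "H * X = Y"
  proof (rule eq_matI)
    fix i j assume "i < dim_row Y" "j < dim_col Y"
    then have ij: "i < n" "j < n" using carr by (auto simp: Y_def n)
    have "(H * X) $$ (i, j) = (\<Sum>k<n. H $$ (i, k) * X $$ (k, j))"
      using cH X ij by (simp add: scalar_prod_def lessThan_atLeast0)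
    also have "\<dots> = Y $$ (i, j)"
    proof (cases "j < a")
      case True
      have "(\<Sum>k<n. H $$ (i, k) * X $$ (k, j)) = (\<Sum>k<n. if k = j then H $$ (i, k) else 0)"
        using True carr by (intro sum.cong) (auto simp: X_def n)
      also have "\<dots> = Y $$ (i, j)"
        using True ij carr by (auto simp: Y_def A_def C_def n)
      finally show ?thesis .
    next
      case False
      have "(\<Sum>k<n. H $$ (i, k) * X $$ (k, j)) = (\<Sum>k<n. H $$ (i, k) * H $$ (j, k))"
        using False ij carr by (intro sum.cong) (auto simp: X_def C_def D_def n)
      also have "\<dots> = (if i = j then real n else 0)"
        using H ij by (rule hadamard_row_sum)
      also have "\<dots> = Y $$ (i, j)"
        using False ij carr by (auto simp: Y_def n)
      finally show ?thesis .
    qed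
    finally show "(H * X) $$ (i, j) = Y $$ (i, j)" .
  qed (use carr cH in \<open>auto simp: X_def Y_def n\<close>)
  then have "det H * det D = det A * real n ^ d"
    using det_mult[OF cH X] detX detY by simp
  then have "(det A * real n ^ d)\<^sup>2 = (det H)\<^sup>2 * (det D)\<^sup>2"
    by (metis power_mult_distrib)
  then show ?thesis
    by (simp add: hadamard_det_square[OF H] A_def D_def power_mult_distrib power_even_eq)
qed

section \<open>Hadamard's determinant inequality\<close>

text \<open>Clearing the zeroth vector from the others turns the Gram matrix into a block triangular one
  whose lower block is again a Gram matrix, of vectors that are no longer than the original ones.\<close>

lemma det_gram_le_prod_norms:
  fixes v :: "nat \<Rightarrow> 'k \<Rightarrow> real"
  shows "det (mat n n (\<lambda>(i, j). \<Sum>k\<in>K. v i k * v j k)) \<le> (\<Prod>i<n. \<Sum>k\<in>K. (v i k)\<^sup>2)"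
proof (induction n arbitrary: v)
  case 0
  then show ?case by simp
next
  case (Suc n)
  define ip where "ip = (\<lambda>x y :: 'k \<Rightarrow> real. \<Sum>k\<in>K. x k * y k)"
  define a where "a = ip (v 0) (v 0)"
  define G where "G = mat (Suc n) (Suc n) (\<lambda>(i, j). ip (v i) (v j))"
  have a_sq: "a = (\<Sum>k\<in>K. (v 0 k)\<^sup>2)"
    by (simp add: a_def ip_def power2_eq_square)
  have a0: "a \<ge> 0" unfolding a_sq by (simp add: sum_nonneg)
  have prodS: "(\<Prod>i<Suc n. \<Sum>k\<in>K. (v i k)\<^sup>2) = a * (\<Prod>i<n. \<Sum>k\<in>K. (v (Suc i) k)\<^sup>2)"
    by (simp only: prod.lessThan_Suc_shift a_sq)
  have pnn: "(\<Prod>i<n. \<Sum>k\<in>K. (v (Suc i) k)\<^sup>2) \<ge> 0"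
    by (simp add: prod_nonneg sum_nonneg)
  \<comment> \<open>\<open>w i\<close> is the component of \<open>v (Suc i)\<close> orthogonal to
    \<open>v 0\<close>; if \<open>a = 0\<close>, division by zero yields 0 and \<open>w i\<close> is
    \<open>v (Suc i)\<close> itself.\<close>
  define w where "w = (\<lambda>i k. v (Suc i) k - ip (v 0) (v (Suc i)) / a * v 0 k)"
  define S where "S = mat n n (\<lambda>(i, j). ip (w i) (w j))"
  have ip_sym: "ip x y = ip y x" for x y
    unfolding ip_def by (simp add: mult.commute)
  have ip_lin: "ip x (\<lambda>k. y k - c * z k) = ip x y - c * ip x z" for x y z c
    unfolding ip_def by (simp add: right_diff_distrib sum_subtractf sum_distrib_left mult.left_commute)
  have ip_w: "ip x (w j) = ip x (v (Suc j)) - ip (v 0) (v (Suc j)) / a * ip x (v 0)" for x j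
    unfolding w_def by (rule ip_lin)
  have "det G = a * det S"
  proof (cases "a = 0")
    case True
    \<comment> \<open>Sums over an infinite set are 0 by convention, so only finite \<open>K\<close>
      needs an argument.\<close>
    have "v 0 k = 0" if "k \<in> K" "finite K" for k
      using True that unfolding a_sq by (subst (asm) sum_nonneg_eq_0_iff) auto
    then have "ip (v 0) x = 0" for x
      unfolding ip_def by (cases "finite K") auto
    then have "G $$ (0, j) = 0" if "j < Suc n" for j
      using that by (simp add: G_def)
    then have "det G = 0"
      by (subst laplace_expansion_row[of _ "Suc n" 0]) (auto simp: G_def)
    then show ?thesis using True by simp
  next
    case False
    define T where "T = mat 1 n (\<lambda>(i, j). - ip (v 0) (v (Suc j)) / a)"
    \<comment> \<open>Multiplying by \<open>X\<close> replaces \<open>v (Suc j)\<close> by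
      \<open>w j\<close> in the second argument of \<open>ip\<close>. As \<open>w j\<close> is
      orthogonal to \<open>v 0\<close>, the first argument may change too, so column operations
      alone produce \<open>S\<close>.\<close>
    define X where "X = four_block_mat (1\<^sub>m 1) T (0\<^sub>m n 1) (1\<^sub>m n)"
    define B where "B = mat n 1 (\<lambda>(i, j). ip (v (Suc i)) (v 0))"
    define Y where "Y = four_block_mat (a \<cdot>\<^sub>m 1\<^sub>m 1) (0\<^sub>m 1 n) B S"
    have c: "T \<in> carrier_mat 1 n" "B \<in> carrier_mat n 1" "S \<in> carrier_mat n n"
      "G \<in> carrier_mat (Suc n) (Suc n)" "X \<in> carrier_mat (Suc n) (Suc n)"
      by (auto simp: T_def B_def S_def G_def X_def)
    have detX: "det X = 1"
      unfolding X_def using c by (subst det_four_block_mat_lower_left_zero) auto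
    have detY: "det Y = a * det S"
      unfolding Y_def using c by (subst det_four_block_mat_upper_right_zero) auto
    have orth: "ip (v 0) (w j) = 0" for j
      using False by (simp add: ip_w flip: a_def)
    have "G * X = Y"
    proof (rule eq_matI)
      fix i j assume "i < dim_row Y" "j < dim_col Y"
      then have ij: "i < Suc n" "j < Suc n" using c by (auto simp: Y_def)
      have "(G * X) $$ (i, j) = (\<Sum>k<Suc n. G $$ (i, k) * X $$ (k, j))"
        using c ij by (simp add: scalar_prod_def lessThan_atLeast0)
      also have "\<dots> = ip (v i) (v 0) * X $$ (0, j) + (\<Sum>k<n. ip (v i) (v (Suc k)) * X $$ (Suc k, j))"
        unfolding sum.lessThan_Suc_shift using ij by (auto simp: G_def intro!: sum.cong)
      also have "\<dots> = Y $$ (i, j)"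
      proof (cases j)
        case 0
        then show ?thesis
          using ij c ip_sym a_def by (cases i) (auto simp: X_def Y_def B_def)
      next
        case (Suc j')
        have "(\<Sum>k<n. ip (v i) (v (Suc k)) * X $$ (Suc k, j)) =
            (\<Sum>k<n. if k = j' then ip (v i) (v (Suc k)) else 0)"
          using c ij Suc by (intro sum.cong) (auto simp: X_def)
        then have "ip (v i) (v 0) * X $$ (0, j) + (\<Sum>k<n. ip (v i) (v (Suc k)) * X $$ (Suc k, j)) =
            ip (v i) (w j')"
          using ij Suc c by (simp add: X_def T_def ip_w)
        also have "\<dots> = Y $$ (i, j)"
        proof (cases i)
          case 0
          then show ?thesis using orth ij c Suc by (simp add: Y_def)
        next
          case (Suc i')
          have "ip (v i) (w j') = ip (w i') (w j') + ip (v 0) (v i) / a * ip (v 0) (w j')"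
            using ip_w[of "w j'" i'] ip_sym Suc by (simp add: algebra_simps)
          then show ?thesis using ij c Suc \<open>j = Suc j'\<close> orth by (simp add: Y_def S_def)
        qed
        finally show ?thesis .
      qed
      finally show "(G * X) $$ (i, j) = Y $$ (i, j)" .
    qed (use c in \<open>auto simp: Y_def\<close>)
    then show ?thesis
      using det_mult[OF c(4,5)] detX detY by simp
  qed
  also have "\<dots> \<le> a * (\<Prod>i<n. \<Sum>k\<in>K. (w i k)\<^sup>2)"
    using Suc.IH[of w] a0 unfolding S_def ip_def by (intro mult_left_mono) auto
  also have "\<dots> \<le> a * (\<Prod>i<n. \<Sum>k\<in>K. (v (Suc i) k)\<^sup>2)"
  proof (intro mult_left_mono prod_mono conjI a0)
    fix i
    define c where "c = ip (v 0) (v (Suc i))"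
    have ip_sq: "ip x x = (\<Sum>k\<in>K. (x k)\<^sup>2)" for x
      by (simp add: ip_def power2_eq_square)
    have "ip (v (Suc i)) (v 0) = c" by (subst ip_sym) (simp add: c_def)
    then have w0: "ip (w i) (v 0) = c - c / a * a" and
      wv: "ip (w i) (v (Suc i)) = ip (v (Suc i)) (v (Suc i)) - c / a * c"
      using ip_w[of "v 0" i] ip_w[of "v (Suc i)" i]
      unfolding ip_sym[of "w i" "v 0"] ip_sym[of "w i" "v (Suc i)"] by (simp_all flip: c_def a_def)
    have "ip (w i) (w i) = ip (v (Suc i)) (v (Suc i)) - c / a * c - c / a * (c - c / a * a)"
      using ip_w[of "w i" i] unfolding w0 wv by (simp flip: c_def)
    also have "\<dots> = ip (v (Suc i)) (v (Suc i)) - c\<^sup>2 / a"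
      by (cases "a = 0") (simp_all add: power2_eq_square)
    finally show "(\<Sum>k\<in>K. (w i k)\<^sup>2) \<le> (\<Sum>k\<in>K. (v (Suc i) k)\<^sup>2)"
      using a0 unfolding ip_sq by simp
  qed (simp add: sum_nonneg)
  finally show ?case unfolding prodS G_def ip_def .
qed

lemma pm1_mats_det_square_le:
  assumes "A \<in> pm1_mats n"
  shows "(det A)\<^sup>2 \<le> real n ^ n"
proof -
  have A: "A \<in> carrier_mat n n" and pm: "\<And>i j. i < n \<Longrightarrow> j < n \<Longrightarrow> A $$ (i, j) = 1 \<or> A $$ (i, j) = -1"
    using assms by (auto simp: pm1_mats_iff)
  have "(det A)\<^sup>2 = det (A * transpose_mat A)"
    using A by (simp add: det_mult[of _ n] det_transpose[of _ n] power2_eq_square)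
  also have "A * transpose_mat A = mat n n (\<lambda>(i, j). \<Sum>k<n. A $$ (i, k) * A $$ (j, k))"
    using A by (intro eq_matI) (auto simp: scalar_prod_def lessThan_atLeast0)
  also have "det \<dots> \<le> (\<Prod>i<n. \<Sum>k<n. (A $$ (i, k))\<^sup>2)"
    by (rule det_gram_le_prod_norms)
  also have "\<dots> = (\<Prod>i<n. \<Sum>k<n. 1)"
    using pm by (intro prod.cong sum.cong refl) (force simp: power2_eq_1_iff)
  finally show ?thesis by simp
qed

section \<open>Orders of Hadamard matrices\<close>

lemma four_dvd_hadamard_order:
  assumes H: "hadamard n H" and n: "n \<ge> 3"
  shows "4 dvd n"
proof -
  have pm: "H $$ (i, j) = 1 \<or> H $$ (i, j) = -1" if "i < n" "j < n" for i j
    using H that by (auto simp: hadamard_def pm1_mats_iff)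
  \<comment> \<open>each \<open>?t j\<close> is 0 or 4, and they sum to \<open>n\<close>\<close>
  let ?t = "\<lambda>j. (H $$ (0, j) + H $$ (1, j)) * (H $$ (0, j) + H $$ (2, j))"
  let ?P = "{j. j < n \<and> ?t j = 4}"
  have "(\<Sum>j<n. ?t j) = (\<Sum>j<n. H $$ (0, j) * H $$ (0, j)) + (\<Sum>j<n. H $$ (0, j) * H $$ (2, j)) +
      (\<Sum>j<n. H $$ (1, j) * H $$ (0, j)) + (\<Sum>j<n. H $$ (1, j) * H $$ (2, j))"
    by (simp add: sum.distrib[symmetric] algebra_simps)
  also have "\<dots> = real n"
    using n by (simp add: hadamard_row_sum[OF H])
  also have "(\<Sum>j<n. ?t j) = (\<Sum>j<n. if ?t j = 4 then 4 else 0)"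
  proof (rule sum.cong)
    fix j assume "j \<in> {..<n}"
    then show "?t j = (if ?t j = 4 then 4 else 0)"
      using pm[of 0 j] pm[of 1 j] pm[of 2 j] n by auto
  qed simp
  also have "\<dots> = real (4 * card ?P)"
    by (subst sum.inter_filter[symmetric]) auto
  finally have "n = 4 * card ?P" by linarith
  then show ?thesis by (rule dvdI)
qed

section \<open>Maximal determinants and bordering\<close>

lemma abs_det_le_maxdet: "A \<in> pm1_mats m \<Longrightarrow> \<bar>det A\<bar> \<le> maxdet m"
  unfolding maxdet_def using finite_pm1_mats by (intro Max_ge) auto

lemma maxdet_attained: obtains A where "A \<in> pm1_mats m" "\<bar>det A\<bar> = maxdet m"
proof -
  have "maxdet m \<in> (\<lambda>A. \<bar>det A\<bar>) ` pm1_mats m"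
    unfolding maxdet_def using finite_pm1_mats pm1_mats_nonempty by (intro Max_in) auto
  then show ?thesis using that by auto
qed

lemma det_square_le_maxdet_square:
  assumes "A \<in> pm1_mats m" shows "(det A)\<^sup>2 \<le> (maxdet m)\<^sup>2"
  using abs_det_le_maxdet[OF assms] abs_le_square_iff[of "det A" "maxdet m"] by linarith

text \<open>Append to an optimal matrix copies of its row 0 and column 0, but with corner
  \<open>-s\<close> instead of \<open>s\<close>. Subtracting column 0 from the last column leaves
  only \<open>-2 * s\<close> there, whence the factor 2.\<close>

lemma maxdet_Suc_ge:
  assumes "m \<ge> 1"
  shows "2 * maxdet m \<le> maxdet (Suc m)"
proof -
  obtain A where A: "A \<in> pm1_mats m" "\<bar>det A\<bar> = maxdet m"
    by (rule maxdet_attained)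
  have cA: "A \<in> carrier_mat m m" using A by (simp add: pm1_mats_iff)
  define s where "s = A $$ (0, 0)"
  have s: "s \<in> {1, -1}" using A assms by (auto simp: s_def pm1_mats_iff)
  define X where "X = four_block_mat A (0\<^sub>m m 1) (mat 1 m (\<lambda>(i, j). A $$ (0, j))) (mat 1 1 (\<lambda>_. - 2 * s))"
  have cX: "X \<in> carrier_mat (Suc m) (Suc m)" using cA by (auto simp: X_def)
  have "det X = det A * (- 2 * s)"
    unfolding X_def using cA
    by (subst det_four_block_mat_upper_right_zero_col[of A m]) (auto simp: det_single)
  then have "2 * maxdet m = \<bar>det (addcol 1 m 0 X)\<bar>"
    using assms A s by (subst det_addcol[OF _ _ cX]) (auto simp: abs_mult)
  also have "addcol 1 m 0 X \<in> pm1_mats (Suc m)"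
  proof -
    have "addcol 1 m 0 X $$ (i, j) \<in> {1, -1}" if "i < Suc m" "j < Suc m" for i j
      using that cA s A(1) assms
      by (cases "i = m"; cases "j = m") (auto simp: X_def pm1_mats_iff simp flip: s_def)
    then show ?thesis using cX by (auto simp: pm1_mats_iff)
  qed
  then have "\<bar>det (addcol 1 m 0 X)\<bar> \<le> maxdet (Suc m)"
    by (rule abs_det_le_maxdet)
  finally show ?thesis .
qed

subsection \<open>The gap between the two bounds\<close>

text \<open>The value 2.74 barely exceeds \<open>(64/63)^64\<close>, the bound obtained from
  \<open>1 + x \<le> exp x\<close> at \<open>x = -1/64\<close>.\<close>

lemma exp_1_le: "exp 1 \<le> (2.74 :: real)"
proof -
  have "1 - 1/64 \<le> exp (- (1/64) :: real)"
    using exp_ge_add_one_self[of "- (1/64) :: real"] by simp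
  then have "(63/64) ^ 64 \<le> exp (- (1/64) :: real) ^ 64"
    by (intro power_mono) auto
  also have "exp (- (1/64) :: real) ^ 64 = inverse (exp 1)"
    using exp_of_nat_mult[of 64 "- (1/64) :: real"] by (simp add: exp_minus)
  finally have "exp 1 \<le> 1 / (63/64 :: real) ^ 64"
    by (simp add: field_simps)
  also have "\<dots> \<le> 2.74" by (simp add: field_simps)
  finally show ?thesis .
qed

text \<open>Reduces numerical bounds for logarithms to comparisons of powers.\<close>

lemma mult_ln_ge_if_power_ge:
  assumes "(x :: real) > 0" "2.74 ^ p \<le> x ^ q"
  shows "real p \<le> real q * ln x"
proof -
  have "exp (real p) \<le> 2.74 ^ p"
    using power_mono[OF exp_1_le, of p] by (simp flip: exp_of_nat_mult)
  then have "exp (real p) \<le> x ^ q" using assms by linarith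
  then have "ln (exp (real p)) \<le> ln (x ^ q)"
    by (subst ln_le_cancel_iff) (use assms in auto)
  then show ?thesis using assms by (simp add: ln_realpow)
qed

text \<open>For \<open>m = n - d\<close>, \<open>gain n d\<close> is the logarithm of
  \<open>m\<^sup>m / (n\<^bsup>n - 2d\<^esup> d\<^sup>d)\<close>: Hadamard's bound for the square of a determinant of order
  \<open>m\<close>, divided by the bound for the square of a minor of order \<open>m\<close> in a Hadamard matrix.\<close>

definition gain :: "real \<Rightarrow> real \<Rightarrow> real" where
  "gain n x = (n - x) * ln (n - x) - (n - 2 * x) * ln n - x * ln x"

lemma gain_half: "n > 0 \<Longrightarrow> gain n (n / 2) = 0"
  by (simp add: gain_def field_simps)

text \<open>Apply \<open>ln y \<le> y - 1\<close> to \<open>y = n / (n - x)\<close>.\<close>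

lemma gain_ge:
  assumes "0 < x" "x < n"
  shows "gain n x \<ge> x * (ln n - ln x - 1)"
proof -
  have "ln (n / (n - x)) \<le> n / (n - x) - 1"
    using assms by (intro ln_le_minus_one) auto
  also have "\<dots> = x / (n - x)" using assms by (simp add: field_simps)
  finally have "ln n - ln (n - x) \<le> x / (n - x)"
    using assms by (simp add: ln_div)
  then have "(n - x) * (ln n - ln (n - x)) \<le> x"
    using assms by (simp add: field_simps)
  then show ?thesis by (simp add: gain_def algebra_simps)
qed

text \<open>The second derivative \<open>1 / (n - x) - 1 / x\<close> is nonpositive up to the
  midpoint, hence the interval.\<close>

lemma concave_gain: "concave_on {0<..n / 2} (gain n)"
  unfolding gain_def
proof (rule f''_le0_imp_concave)
  fix x assume x: "x \<in> {0<..n / 2}"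
  show "((\<lambda>x. (n - x) * ln (n - x) - (n - 2 * x) * ln n - x * ln x) has_real_derivative
      2 * ln n - 2 - ln (n - x) - ln x) (at x)"
  proof -
    have "x > 0" "n - x > 0" using x by auto
    then show ?thesis by (auto intro!: derivative_eq_intros)
  qed
  show "((\<lambda>x. 2 * ln n - 2 - ln (n - x) - ln x) has_real_derivative 1 / (n - x) - 1 / x) (at x)"
    using x by (auto intro!: derivative_eq_intros simp: field_simps)
  show "1 / (n - x) - 1 / x \<le> 0"
    using x by (auto simp: field_simps)
qed simp

text \<open>At \<open>n / 7\<close> the terms in \<open>ln n\<close> cancel, leaving
  \<open>n / 7 * (6 * ln 6 - 5 * ln 7)\<close>; the second factor is at least 1 because
  \<open>exp 1 * 7^5 \<le> 6^6\<close>.\<close>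

lemma gain_seventh_ge:
  assumes "n > 0"
  shows "gain n (n / 7) \<ge> n / 7"
proof -
  have "(exp 1 :: real) * 7 ^ 5 \<le> 2.74 * 7 ^ 5"
    by (intro mult_right_mono exp_1_le) auto
  also have "\<dots> \<le> 6 ^ 6" by simp
  finally have "ln ((exp 1 :: real) * 7 ^ 5) \<le> ln (6 ^ 6)"
    by (subst ln_le_cancel_iff) auto
  then have "1 + 5 * ln 7 \<le> 6 * ln (6 :: real)"
    by (simp add: ln_mult ln_realpow del: power_numeral)
  then have "n / 7 * 1 \<le> n / 7 * (6 * ln 6 - 5 * ln 7)"
    using assms by (intro mult_left_mono) auto
  also have "n - n / 7 = n * 6 / 7" "n - 2 * (n / 7) = 5 * n / 7" by auto
  then have "n / 7 * (6 * ln 6 - 5 * ln 7) = gain n (n / 7)"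
    using assms unfolding gain_def by (simp add: ln_div ln_mult field_simps)
  finally show ?thesis by simp
qed

text \<open>The bound matches the loss in the weakest lower estimate for \<open>maxdet\<close>, the
  one for \<open>m mod 4 = 2\<close>. Chords between 6, \<open>n / 7\<close> and
  \<open>n / 2\<close> lie below the graph by concavity.\<close>

lemma gain_ge_if_ge_6:
  assumes x: "6 \<le> x" and xn: "x \<le> n / 2 - 5 * ln n" and n: "n > 1"
  shows "gain n x \<ge> 2 * ln n - 2 * ln 2"
proof -
  \<comment> \<open>\<open>6 \<le> x \<le> n / 2 - 5 ln n\<close> forces \<open>n \<ge> 48\<close>, by bootstrapping\<close>
  have n12: "n \<ge> 12 + 10 * ln n" using x xn by auto
  have lnpos: "ln n > 0" using n by simp
  have "2 \<le> 1 * ln n"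
    using mult_ln_ge_if_power_ge[of n 2 1] n12 lnpos by (simp add: power2_eq_square)
  then have n32: "n \<ge> 32" using n12 by simp
  then have "3 \<le> ln n"
    using mult_ln_ge_if_power_ge[of n 3 1] by (simp add: eval_nat_numeral)
  then have n42: "n \<ge> 42" using n12 by simp
  have "real 18 \<le> real 5 * ln n"
  proof (rule mult_ln_ge_if_power_ge)
    have "(2.74 :: real) ^ 18 \<le> 42 ^ 5" by (simp add: power_divide)
    also have "\<dots> \<le> n ^ 5" using n42 by (intro power_mono) auto
    finally show "2.74 ^ 18 \<le> n ^ 5" .
  qed (use n in auto)
  then have n48: "n \<ge> 48" using n12 by simp
  have x2: "x < n / 2" using xn lnpos by simp
  have chord: "gain n ((1 - t) * a + t * b) \<ge> (1 - t) * gain n a + t * gain n b"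
    if "0 \<le> t" "t \<le> 1" "a \<in> {0<..n/2}" "b \<in> {0<..n/2}" for t a b
    using concave_onD[OF concave_gain that] by simp
  have seventh: "gain n (n / 7) \<ge> n / 7" using gain_seventh_ge n by simp
  show ?thesis
  proof (cases "x \<ge> n / 7")
    case True
    define t where "t = (x - n / 7) / (5 * n / 14)"
    have t: "0 \<le> t" "t \<le> 1" "x = (1 - t) * (n / 7) + t * (n / 2)"
      using True x2 n by (auto simp: t_def field_simps)
    \<comment> \<open>The line from height \<open>n / 7\<close> at \<open>n / 7\<close> down to 0 at
      \<open>n / 2\<close> has slope -2/5. Since 2/5 of \<open>5 * ln n\<close> is
      \<open>2 * ln n\<close>, this is where the constant 5 is used.\<close>
    have "2 * ln n \<le> 2 / 5 * (n / 2 - x)" using xn by simp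
    also have "\<dots> = (1 - t) * (n / 7)"
      using n by (simp add: t_def field_simps)
    also have "\<dots> \<le> (1 - t) * gain n (n / 7)"
      using seventh t by (intro mult_left_mono) auto
    also have "\<dots> \<le> gain n x"
      using chord[of t "n / 7" "n / 2"] t n gain_half[of n] by simp
    finally show ?thesis using ln_ge_zero[of "2 :: real"] by linarith
  next
    case False
    \<comment> \<open>The tangent to \<open>ln\<close> at 32 gives
      \<open>2 * ln n - 2 * ln 2 \<le> n / 16 + 3.84\<close>, which \<open>n \<ge> 48\<close> just
      brings below \<open>n / 7\<close>.\<close>
    have "ln (n / 32) \<le> n / 32 - 1" using n by (intro ln_le_minus_one) auto
    moreover have "ln (n / 32) = ln n - 5 * ln 2"
      using n ln_realpow[of 2 5] by (simp add: ln_div)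
    moreover have "ln (2 :: real) \<le> 0.73"
    proof -
      have "ln (2 :: real) \<le> ln (1.091 ^ 8)" by (intro ln_mono) (auto simp: power_divide)
      also have "\<dots> = 8 * ln 1.091" by (subst ln_realpow) auto
      also have "\<dots> \<le> 0.73" using ln_le_minus_one[of "1.091 :: real"] by simp
      finally show ?thesis .
    qed
    ultimately have low7: "2 * ln n - 2 * ln 2 \<le> gain n (n / 7)"
      using seventh n48 by simp
    \<comment> \<open>By \<open>gain_ge\<close>, the bound at 6 reduces to
      \<open>(6 * exp 1)^6 \<le> 4 * n^4\<close>.\<close>
    have "ln ((6 * exp 1 :: real) ^ 6) \<le> ln (4 * n ^ 4)"
    proof (subst ln_le_cancel_iff)
      have "(6 * exp 1) ^ 6 \<le> (6 * 2.74 :: real) ^ 6"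
        using exp_1_le by (intro power_mono) auto
      also have "\<dots> \<le> 4 * 48 ^ 4" by (simp add: power_divide)
      also have "\<dots> \<le> 4 * n ^ 4" using n48 by (intro mult_left_mono power_mono) auto
      finally show "(6 * exp 1) ^ 6 \<le> 4 * n ^ 4" .
    qed (use n in auto)
    moreover have "ln ((6 * exp 1 :: real) ^ 6) = 6 * (ln 6 + 1)"
      by (subst ln_realpow) (auto simp: ln_mult)
    moreover have "ln (4 :: real) = 2 * ln 2"
      using ln_realpow[of 2 2] by simp
    ultimately have "6 * (ln 6 + 1) \<le> 2 * ln 2 + 4 * ln n"
      using n by (simp add: ln_realpow ln_mult)
    then have low6: "2 * ln n - 2 * ln 2 \<le> gain n 6"
      using gain_ge[of 6 n] n48 by simp
    define t where "t = (x - 6) / (n / 7 - 6)"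
    have pos: "n / 7 - 6 > 0" using False x by simp
    have t: "0 \<le> t" "t \<le> 1"
      using False x pos by (auto simp: t_def field_simps)
    have "t * (n / 7 - 6) = x - 6" using pos by (simp add: t_def)
    then have xt: "x = (1 - t) * 6 + t * (n / 7)"
      by (simp add: algebra_simps)
    have "2 * ln n - 2 * ln 2 = (1 - t) * (2 * ln n - 2 * ln 2) + t * (2 * ln n - 2 * ln 2)"
      by (simp add: algebra_simps)
    also have "\<dots> \<le> (1 - t) * gain n 6 + t * gain n (n / 7)"
      using low6 low7 t by (intro add_mono mult_left_mono) auto
    also have "\<dots> \<le> gain n x"
      using chord[of t 6 "n / 7"] t n48 xt by simp
    finally show ?thesis .
  qed
qed

text \<open>In the application \<open>d = 4\<close> makes \<open>m\<close> divisible by 4 and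
  Hadamard's bound is attained, so positive gain suffices; for \<open>d = 3\<close> and
  \<open>d = 5\<close> a factor \<open>m\<close> may be lost.\<close>

lemma gain_gt_if_le_5:
  fixes d :: nat
  assumes d: "3 \<le> d" "d \<le> 5" and dn: "real d \<le> n / 2 - 5 * ln n" and n: "n > 1"
  shows "gain n d > (if d = 4 then 0 else ln n)"
proof -
  \<comment> \<open>Each lower bound for \<open>ln n\<close> improves the one for \<open>n\<close>,
    from 6 up to 36.\<close>
  have n6: "n \<ge> 6 + 10 * ln n" using d dn by auto
  have lnpos: "ln n > 0" using n by simp
  then have "1 \<le> ln n"
    using mult_ln_ge_if_power_ge[of n 1 1] n6 by simp
  then have n16: "n \<ge> 16" using n6 by simp
  then have "2 \<le> ln n"
    using mult_ln_ge_if_power_ge[of n 2 1] by (simp add: power2_eq_square)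
  then have "n \<ge> 26" using n6 by simp
  then have "3 \<le> ln n"
    using mult_ln_ge_if_power_ge[of n 3 1] by (simp add: eval_nat_numeral)
  then have n36: "n \<ge> 36" using n6 by simp
  \<comment> \<open>\<open>q\<close> will be \<open>d\<close> minus the multiple of
    \<open>ln n\<close> that the gain has to exceed.\<close>
  have key: "real d * (ln d + 1) < real q * ln n" if "(real d * 2.74) ^ d < 36 ^ q" for q
  proof -
    have "(real d * exp 1) ^ d \<le> (real d * 2.74) ^ d"
      using exp_1_le by (intro power_mono mult_left_mono) auto
    also have "\<dots> < 36 ^ q" by (rule that)
    also have "\<dots> \<le> n ^ q" using n36 by (intro power_mono) auto
    finally have "ln ((real d * exp 1) ^ d) < ln (n ^ q)"
      by (subst ln_less_cancel_iff) (use n d in auto)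
    then show ?thesis using n d by (simp add: ln_realpow ln_mult)
  qed
  have g: "gain n d \<ge> real d * (ln n - ln d - 1)"
    using d n36 by (intro gain_ge) auto
  consider "d = 3" | "d = 4" | "d = 5" using d by linarith
  then show ?thesis
  proof cases
    case 1 then show ?thesis using g key[of 2] by (simp add: algebra_simps power_divide)
  next
    case 2 then show ?thesis using g key[of 4] by (simp add: algebra_simps power_divide)
  next
    case 3 then show ?thesis using g key[of 4] by (simp add: algebra_simps power_divide)
  qed
qed

subsection \<open>Minors of Hadamard matrices\<close>

text \<open>\<open>submatrix\<close> enumerates the chosen rows and columns by \<open>pick\<close>;
  extending this to a permutation moves any submatrix to the leading block.\<close>

lemma ex_bij_extending_pick:
  assumes I: "I \<subseteq> {..<n}" and m: "card I = m"
  shows "\<exists>f. bij_betw f {..<n} {..<n} \<and> (\<forall>i<m. f i = pick I i)"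
proof -
  have fin: "finite I" using I finite_subset by auto
  have mn: "m \<le> n" using card_mono[OF _ I] m by simp
  have inj: "inj_on (pick I) {..<m}"
    using pick_mono_le[of _ I] m by (intro linorder_inj_onI') (auto dest: less_imp_neq)
  have "pick I ` {..<m} \<subseteq> I" using pick_in_set_le m by auto
  then have "pick I ` {..<m} = I"
    using card_subset_eq[OF fin] card_image[OF inj] m by simp
  with inj have p: "bij_betw (pick I) {..<m} I" by (simp add: bij_betw_def)
  have "card {m..<n} = card ({..<n} - I)"
    using I m fin by (simp add: card_Diff_subset)
  then obtain h where h: "bij_betw h {m..<n} ({..<n} - I)"
    using finite_same_card_bij[of "{m..<n}" "{..<n} - I"] by auto
  have "bij_betw (\<lambda>i. if i \<in> {..<m} then pick I i else h i) ({..<m} \<union> {m..<n}) (I \<union> ({..<n} - I))"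
    using p h by (rule bij_betw_disjoint_Un) auto
  moreover have "{..<m} \<union> {m..<n} = {..<n}" "I \<union> ({..<n} - I) = {..<n}"
    using mn I by auto
  ultimately show ?thesis by (intro exI[of _ "\<lambda>i. if i \<in> {..<m} then pick I i else h i"]) auto
qed

lemma hadamard_minor_square_le:
  assumes H: "hadamard n H" and n: "n = m + d"
    and I: "I \<subseteq> {..<n}" "card I = m" and J: "J \<subseteq> {..<n}" "card J = m"
  shows "(det (submatrix H I J))\<^sup>2 * real n ^ (2 * d) \<le> real n ^ n * real d ^ d"
proof -
  obtain f where f: "bij_betw f {..<n} {..<n}" "\<And>i. i < m \<Longrightarrow> f i = pick I i"
    using ex_bij_extending_pick[OF I] by blast
  obtain g where g: "bij_betw g {..<n} {..<n}" "\<And>i. i < m \<Longrightarrow> g i = pick J i"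
    using ex_bij_extending_pick[OF J] by blast
  define K where "K = mat n n (\<lambda>(i, j). H $$ (f i, g j))"
  have K: "hadamard n K"
    unfolding K_def using H f(1) g(1) by (rule hadamard_permute)
  have "H \<in> carrier_mat n n" using H by (simp add: hadamard_def pm1_mats_iff)
  moreover have "{i. i < n \<and> i \<in> I} = I" "{j. j < n \<and> j \<in> J} = J" using I J by auto
  ultimately have "submatrix H I J = mat m m (\<lambda>(i, j). K $$ (i, j))"
    using I J f(2) g(2) n by (intro eq_matI) (auto simp: submatrix_def K_def)
  moreover have "mat d d (\<lambda>(i, j). K $$ (m + i, m + j)) \<in> pm1_mats d"
    using K n by (auto simp: hadamard_def pm1_mats_iff)
  ultimately show ?thesis
    using hadamard_complementary_minor[OF K n] pm1_mats_det_square_le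
    by (simp add: mult_left_mono)
qed

lemma hadamard_power_le_maxdet_square:
  assumes "hadamard n H"
  shows "real n ^ n \<le> (maxdet n)\<^sup>2"
  using det_square_le_maxdet_square[of H n] assms hadamard_det_square[OF assms]
  by (simp add: hadamard_def)

lemma hadamard_maxdet_complement_ge:
  assumes H: "hadamard n H" and n: "n = a + d"
  shows "real n ^ n * (det (mat d d (\<lambda>(i, j). H $$ (a + i, a + j))))\<^sup>2 \<le>
    (maxdet a)\<^sup>2 * real n ^ (2 * d)"
proof -
  have "mat a a (\<lambda>(i, j). H $$ (i, j)) \<in> pm1_mats a"
    using H n by (auto simp: hadamard_def pm1_mats_iff)
  then show ?thesis
    using hadamard_complementary_minor[OF assms, symmetric] det_square_le_maxdet_square
    by (simp add: mult_right_mono)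
qed

text \<open>The complementary minor is a single entry, whose square is 1.\<close>

lemma maxdet_ge_hadamard_minus_1:
  assumes H: "hadamard (Suc k) H"
  shows "real (Suc k) ^ (Suc k) \<le> (maxdet k)\<^sup>2 * real (Suc k) ^ 2"
proof -
  have "H $$ (k, k) = 1 \<or> H $$ (k, k) = -1"
    using H by (auto simp: hadamard_def pm1_mats_iff)
  then have "(det (mat 1 1 (\<lambda>(i, j). H $$ (k + i, k + j))))\<^sup>2 = 1"
    by (subst det_single) auto
  then show ?thesis
    using hadamard_maxdet_complement_ge[OF H, of k 1] by simp
qed

text \<open>Two rows of a Hadamard matrix agree in some column and disagree in another, which
  gives a Hadamard submatrix of order 2.\<close>

lemma maxdet_ge_hadamard_minus_2:
  assumes H: "hadamard (k + 2) H"
  shows "4 * real (k + 2) ^ (k + 2) \<le> (maxdet k)\<^sup>2 * real (k + 2) ^ 4"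
proof -
  let ?n = "k + 2"
  have pm: "H $$ (i, j) = 1 \<or> H $$ (i, j) = -1" if "i < ?n" "j < ?n" for i j
    using H that by (auto simp: hadamard_def pm1_mats_iff)
  let ?x = "\<lambda>j. H $$ (k, j)" and ?y = "\<lambda>j. H $$ (Suc k, j)"
  have sum0: "(\<Sum>j<?n. ?x j * ?y j) = 0"
    using hadamard_row_sum[OF H, of k "Suc k"] by simp
  have "\<exists>p<?n. ?x p = ?y p"
  proof (rule ccontr)
    assume *: "\<not> (\<exists>p<?n. ?x p = ?y p)"
    have "(\<Sum>j<?n. ?x j * ?y j) = (\<Sum>j<?n. -1)"
    proof (rule sum.cong)
      fix j assume "j \<in> {..<?n}"
      then show "?x j * ?y j = -1" using * pm[of k j] pm[of "Suc k" j] by auto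
    qed simp
    then show False using sum0 by simp
  qed
  then obtain p where p: "p < ?n" "?x p = ?y p" by blast
  have "\<exists>q<?n. ?x q \<noteq> ?y q"
  proof (rule ccontr)
    assume *: "\<not> (\<exists>q<?n. ?x q \<noteq> ?y q)"
    have "(\<Sum>j<?n. ?x j * ?y j) = (\<Sum>j<?n. 1)"
    proof (rule sum.cong)
      fix j assume "j \<in> {..<?n}"
      then show "?x j * ?y j = 1" using * pm[of k j] by auto
    qed simp
    then show False using sum0 by simp
  qed
  then obtain q where q: "q < ?n" "?x q \<noteq> ?y q" by blast
  have "p \<noteq> q" using p q by auto
  \<comment> \<open>\<open>transpose k p\<close> sends \<open>r\<close> to \<open>q\<close>; the
    inner transposition carries \<open>Suc k\<close> to \<open>r\<close> and fixes \<open>k\<close>,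
    as \<open>r \<noteq> k\<close>.\<close>
  define r where "r = transpose k p q"
  define g where "g = transpose k p \<circ> transpose (Suc k) r"
  have r: "r < ?n" "r \<noteq> k" using p q \<open>p \<noteq> q\<close> by (auto simp: r_def transpose_def)
  have "g permutes {..<?n}"
    unfolding g_def using p r by (intro permutes_compose permutes_swap_id) auto
  then have g: "bij_betw g {..<?n} {..<?n}" by (rule permutes_imp_bij)
  have gk: "g k = p" "g (Suc k) = q"
    using r \<open>p \<noteq> q\<close> by (auto simp: g_def r_def transpose_def split: if_splits)
  define K where "K = mat ?n ?n (\<lambda>(i, j). H $$ (i, g j))"
  have K: "hadamard ?n K"
    using hadamard_permute[OF H _ g, of "\<lambda>i. i"] by (simp add: K_def bij_betw_def)
  have "hadamard 2 (mat 2 2 (\<lambda>(i, j). K $$ (k + i, k + j)))"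
  proof (rule hadamardI)
    show "mat 2 2 (\<lambda>(i, j). K $$ (k + i, k + j)) \<in> pm1_mats 2"
      using K by (auto simp: hadamard_def pm1_mats_iff)
    fix i l :: nat assume "i < 2" "l < 2"
    then have "i = 0 \<or> i = 1" "l = 0 \<or> l = 1" by auto
    then show "(\<Sum>j<2. mat 2 2 (\<lambda>(i, j). K $$ (k + i, k + j)) $$ (i, j) *
        mat 2 2 (\<lambda>(i, j). K $$ (k + i, k + j)) $$ (l, j)) = (if i = l then real 2 else 0)"
      using pm[of k p] pm[of "Suc k" p] pm[of k q] pm[of "Suc k" q] p q gk
      by (auto simp: numeral_2_eq_2 K_def)
  qed
  then have "(det (mat 2 2 (\<lambda>(i, j). K $$ (k + i, k + j))))\<^sup>2 = 4"
    by (simp add: hadamard_det_square)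
  then show ?thesis
    using hadamard_maxdet_complement_ge[OF K, of k 2] by simp
qed

section \<open>Lower bounds for maximal determinants by residue class\<close>

lemma hadamard_conjectureE:
  assumes "hadamard_conjecture" "n > 0" "4 dvd n"
  obtains H where "hadamard n H"
  using assms unfolding hadamard_conjecture_def
  by (metis One_nat_def Suc_leI dvdE nat_0_less_mult_iff)

lemma ln_maxdet_square_ge_dvd_4:
  assumes HC: "hadamard_conjecture" and m: "m > 0" "4 dvd m"
  shows "real m * ln m \<le> ln ((maxdet m)\<^sup>2)"
proof -
  obtain H where "hadamard m H" using HC m by (rule hadamard_conjectureE)
  then have "ln (real m ^ m) \<le> ln ((maxdet m)\<^sup>2)"
    using m hadamard_power_le_maxdet_square by (intro ln_mono) auto
  then show ?thesis using m by (simp add: ln_realpow)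
qed

text \<open>Delete a row and a column from a Hadamard matrix of order \<open>m + 1\<close>, then
  weaken the base \<open>m + 1\<close> to \<open>m\<close>.\<close>

lemma ln_maxdet_square_ge_mod_4_eq_3:
  assumes HC: "hadamard_conjecture" and m: "m mod 4 = 3"
  shows "(real m - 1) * ln m \<le> ln ((maxdet m)\<^sup>2)"
proof -
  have "4 dvd Suc m" using m by presburger
  then obtain H where H: "hadamard (Suc m) H"
    using hadamard_conjectureE[OF HC] by blast
  have m3: "m \<ge> 3" using m by presburger
  have "Suc m = (m - 1) + 2" using m3 by simp
  then have "real (Suc m) ^ Suc m = real (Suc m) ^ (m - 1) * real (Suc m) ^ 2"
    by (metis power_add)
  then have "real (Suc m) ^ (m - 1) \<le> (maxdet m)\<^sup>2"
    using maxdet_ge_hadamard_minus_1[OF H] by simp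
  moreover have "real m ^ (m - 1) \<le> real (Suc m) ^ (m - 1)"
    by (intro power_mono) auto
  ultimately have "real m ^ (m - 1) \<le> (maxdet m)\<^sup>2" by linarith
  then have "ln (real m ^ (m - 1)) \<le> ln ((maxdet m)\<^sup>2)"
    using m3 by (intro ln_mono) auto
  then show ?thesis using m3 by (simp add: ln_realpow of_nat_diff)
qed

text \<open>Bordering a Hadamard matrix of order \<open>k = m - 1\<close> gains
  \<open>ln 4 \<ge> 1\<close>, which pays for replacing \<open>k * ln k\<close> by
  \<open>k * ln m\<close>.\<close>

lemma ln_maxdet_square_ge_mod_4_eq_1:
  assumes HC: "hadamard_conjecture" and m: "m mod 4 = 1" "m > 1"
  shows "(real m - 1) * ln m \<le> ln ((maxdet m)\<^sup>2)"
proof -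
  obtain k where k: "m = Suc k" "k > 0" "4 dvd k"
    using m by (intro that[of "m - 1"]) presburger+
  have pos: "(maxdet k)\<^sup>2 > 0"
  proof -
    obtain H where "hadamard k H" using HC k(2,3) by (rule hadamard_conjectureE)
    then have "real k ^ k \<le> (maxdet k)\<^sup>2" by (rule hadamard_power_le_maxdet_square)
    then show ?thesis using k by (smt (verit) zero_less_power of_nat_0_less_iff)
  qed
  have "maxdet k \<ge> 0" using maxdet_attained[of k] by (metis abs_ge_zero)
  then have "(2 * maxdet k)\<^sup>2 \<le> (maxdet m)\<^sup>2"
    using maxdet_Suc_ge[of k] k by (intro power_mono) auto
  then have "ln (4 * (maxdet k)\<^sup>2) \<le> ln ((maxdet m)\<^sup>2)"
    using pos by (intro ln_mono) (auto simp: power_mult_distrib)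
  moreover have "ln (4 * (maxdet k)\<^sup>2) = ln 4 + ln ((maxdet k)\<^sup>2)"
    using pos by (subst ln_mult) auto
  moreover have "real k * ln k \<le> ln ((maxdet k)\<^sup>2)"
    using ln_maxdet_square_ge_dvd_4[OF HC] k by simp
  moreover have "real k * ln m \<le> real k * ln k + 1"
  proof -
    have "ln (real m / real k) \<le> real m / real k - 1"
      using k by (intro ln_le_minus_one) auto
    also have "\<dots> = 1 / k" using k by (simp add: field_simps)
    finally have "ln m - ln k \<le> 1 / k" using k by (simp add: ln_div)
    then show ?thesis using k by (simp add: field_simps)
  qed
  moreover have "ln (4 :: real) \<ge> 1"
    using mult_ln_ge_if_power_ge[of 4 1 1] by simp
  ultimately show ?thesis using k by simp
qed

text \<open>Delete two rows and two columns from order \<open>m + 2\<close>; the factor 4 is the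
  squared determinant of the complementary Hadamard block of order 2.\<close>

lemma ln_maxdet_square_ge_mod_4_eq_2:
  assumes HC: "hadamard_conjecture" and m: "m mod 4 = 2"
  shows "(real m - 2) * ln m + 2 * ln 2 \<le> ln ((maxdet m)\<^sup>2)"
proof -
  have "4 dvd m + 2" using m by presburger
  then obtain H where H: "hadamard (m + 2) H"
    using hadamard_conjectureE[OF HC, of "m + 2"] by auto
  have m2: "m \<ge> 2" using m by presburger
  have "m + 2 = (m - 2) + 4" using m2 by simp
  then have "real (m + 2) ^ (m + 2) = real (m + 2) ^ (m - 2) * real (m + 2) ^ 4"
    by (metis power_add)
  then have "(4 * real (m + 2) ^ (m - 2)) * real (m + 2) ^ 4 \<le> (maxdet m)\<^sup>2 * real (m + 2) ^ 4"
    using maxdet_ge_hadamard_minus_2[OF H] by (simp only: mult.assoc)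
  then have "4 * real (m + 2) ^ (m - 2) \<le> (maxdet m)\<^sup>2"
    by (rule mult_right_le_imp_le) simp
  moreover have "4 * real m ^ (m - 2) \<le> 4 * real (m + 2) ^ (m - 2)"
    by (intro mult_left_mono power_mono) auto
  ultimately have "2 ^ 2 * real m ^ (m - 2) \<le> (maxdet m)\<^sup>2" by simp
  then have "ln (2 ^ 2 * real m ^ (m - 2)) \<le> ln ((maxdet m)\<^sup>2)"
    using m2 by (intro ln_mono) auto
  also have "ln (2 ^ 2 * real m ^ (m - 2)) = 2 * ln 2 + ln (real m ^ (m - 2))"
    using m2 ln_realpow[of 2 2] by (subst ln_mult) auto
  finally show ?thesis using m2 by (simp add: ln_realpow of_nat_diff)
qed

section \<open>Contradiction between the two bounds\<close>

theorem theorem4: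
  fixes n m :: nat and H :: "real mat" and I J :: "nat set"
  assumes "hadamard_conjecture"
    and "hadamard n H"
    and "1 \<le> m" and "m < n"
    and "I \<subseteq> {..<n}" and "card I = m"
    and "J \<subseteq> {..<n}" and "card J = m"
    and "\<bar>det (submatrix H I J)\<bar> = maxdet m"
  shows "real m < real n / 2 + 5 * ln (real n) \<or> real m \<ge> real n - 2"
proof (rule ccontr)
  assume "\<not> ?thesis"
  then have big: "real n / 2 + 5 * ln n \<le> m" and small: "real m < real n - 2" by auto
  obtain d where d: "n = m + d" using \<open>m < n\<close> less_imp_add_positive by auto
  then have nd: "real n = real m + real d" by simp
  have d3: "d \<ge> 3" using small d by auto
  have n: "n > 3" using \<open>1 \<le> m\<close> d d3 by simp
  have "4 dvd n" using four_dvd_hadamard_order[OF \<open>hadamard n H\<close>] n by simp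
  then have mod: "(m + d) mod 4 = 0" using d by simp
  have dn: "real d \<le> real n / 2 - 5 * ln n"
    using big nd by argo
  have lnpos: "ln (real n) > 0" using n by simp
  have "real d < real m" using dn lnpos nd by argo
  then have dm: "d < m" by simp
  let ?D = "(maxdet m)\<^sup>2"
  \<comment> \<open>\<open>d\<close> equal to 3, 4, 5 puts \<open>m\<close> in the classes 1, 0, 3
    modulo 4, which avoids the weak class 2.\<close>
  have lower: "(real m - (if d = 4 then 0 else 1)) * ln m \<le> ln ?D" if d5: "d \<le> 5"
  proof -
    consider "d = 3" | "d = 4" | "d = 5" using d3 d5 by linarith
    then show ?thesis
    proof cases
      case 1
      then have "m mod 4 = 1" using mod by presburger
      then show ?thesis using ln_maxdet_square_ge_mod_4_eq_1 assms(1) dm 1 by simp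
    next
      case 2
      then have "4 dvd m" using mod by presburger
      then show ?thesis using ln_maxdet_square_ge_dvd_4 assms(1) dm 2 by simp
    next
      case 3
      then have "m mod 4 = 3" using mod by presburger
      then show ?thesis using ln_maxdet_square_ge_mod_4_eq_3 assms(1) 3 by simp
    qed
  qed
  have lower': "(real m - 2) * ln m + 2 * ln 2 \<le> ln ?D"
  proof -
    \<comment> \<open>As \<open>m \<ge> 4\<close>, losing \<open>m\<close> is no better than gaining
      4 after losing \<open>m^2\<close>: every class satisfies the bound of class 2.\<close>
    have "ln 4 \<le> ln (real m)" using dm d3 by (intro ln_mono) auto
    then have "2 * ln 2 \<le> ln (real m)" using ln_realpow[of 2 2] by simp
    moreover have "ln (2 :: real) \<ge> 0" by simp
    moreover have "4 dvd m \<or> m mod 4 = 1 \<or> m mod 4 = 2 \<or> m mod 4 = 3"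
      by presburger
    then have "real m * ln m \<le> ln ?D \<or> (real m - 1) * ln m \<le> ln ?D \<or>
        (real m - 2) * ln m + 2 * ln 2 \<le> ln ?D"
      by (elim disjE) (use ln_maxdet_square_ge_mod_4_eq_1 ln_maxdet_square_ge_dvd_4
        ln_maxdet_square_ge_mod_4_eq_2 ln_maxdet_square_ge_mod_4_eq_3 assms(1) dm d3 in auto)
    ultimately show ?thesis unfolding left_diff_distrib by linarith
  qed
  have pos: "?D > 0"
  proof (rule ccontr)
    assume "\<not> ?D > 0"
    then have "?D = 0" by simp
    \<comment> \<open>\<open>ln 0 = 0\<close> by convention, so a vanishing \<open>maxdet m\<close>
      turns \<open>lower'\<close> into a false inequality.\<close>
    then have "(real m - 2) * ln m + 2 * ln 2 \<le> 0" using lower' by simp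
    moreover have "(real m - 2) * ln m > 0" using dm d3 by (intro mult_pos_pos) auto
    ultimately show False using ln_gt_zero[of "2 :: real"] by linarith
  qed
  have "(det (submatrix H I J))\<^sup>2 = ?D"
    using assms(9) by (metis power2_abs)
  then have "?D * real n ^ (2 * d) \<le> real n ^ n * real d ^ d"
    using hadamard_minor_square_le[OF assms(2) d assms(5-8)] by simp
  then have "ln (?D * real n ^ (2 * d)) \<le> ln (real n ^ n * real d ^ d)"
    using pos n by (intro ln_mono) auto
  then have "ln ?D + real (2 * d) * ln n \<le> real n * ln n + real d * ln d"
    using pos n d3 by (simp add: ln_mult ln_realpow)
  then have upper: "gain n d \<le> real m * ln m - ln ?D"
    using d by (simp add: gain_def algebra_simps)
  have lnmn: "ln (real m) < ln n" using \<open>1 \<le> m\<close> \<open>m < n\<close> by simp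
  \<comment> \<open>The lower bounds turn \<open>upper\<close> into a bound for the gain by 0,
    \<open>ln m\<close> or \<open>2 * ln m - 2 * ln 2\<close>; the contradiction is strict by the
    strict gain bound or by \<open>ln m < ln n\<close>.\<close>
  show False
  proof (cases "d \<le> 5")
    case True
    show False
      using gain_gt_if_le_5[OF d3 True dn] lower[OF True] upper lnmn n
      by (auto simp: algebra_simps split: if_splits)
  next
    case False
    show False
      using gain_ge_if_ge_6[OF _ dn] False lower' upper lnmn n by (auto simp: algebra_simps)
  qed
qed

end
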